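(* Let $\mathbf{A}\in\mathbb{R}^{m\times n}$, $\mathbf{b}\in\mathbb{R}^m$, $\mathbf{c},\mathbf{d}\in\mathbb{R}^n$, $\alpha,\beta\in\mathbb{R}$ be such that $X=\{\mathbf{x}\in\mathbb{R}^n \mid \mathbf{A}\mathbf{x}\le\mathbf{b},\ \mathbf{x}\ge\mathbf{0}_n\}$ is non-empty and bounded and $\mathbf{d}^T\mathbf{x}+\beta>0$ for all $\mathbf{x}\in X$. Then there exists a strict complementary solution for the primal linear fractional program $\max\{(\mathbf{c}^T\mathbf{x}+\alpha)/(\mathbf{d}^T\mathbf{x}+\beta) \mid \mathbf{x}\in X\}$ and its dual $\min\{z \mid \mathbf{A}^T\mathbf{y}+\mathbf{d}z\ge\mathbf{c},\ -\mathbf{b}^T\mathbf{y}+\beta z=\alpha,\ \mathbf{y}\ge\mathbf{0}_m\}$ (with $\mathbf{y}\in\mathbb{R}^m$ and $z\in\mathbb{R}$ free in sign).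
   Context: Vector inequalities are componentwise; $\mathbf{0}_k$ is the zero vector of $\mathbb{R}^k$. A feasible primal-dual solution is a pair $\left((\mathbf{x}^*,\mathbf{u}^* ),(\mathbf{y}^*,z^*,\mathbf{v}^* )\right)$ where $\mathbf{x}^*$ is feasible for the primal problem, $(\mathbf{y}^*,z^* )$ is feasible for the dual problem, and $\mathbf{u}^*:=\mathbf{b}-\mathbf{A}\mathbf{x}^*$, $\mathbf{v}^*:=\mathbf{A}^T\mathbf{y}^*+\mathbf{d}z^*-\mathbf{c}$ are the slack vectors. It is called a strict complementary solution if $$\mathbf{x}^{*T}\mathbf{v}^*=0,\quad \mathbf{y}^{*T}\mathbf{u}^*=0,\quad \mathbf{x}^*+\mathbf{v}^*>\mathbf{0}_n,\quad \mathbf{y}^*+\mathbf{u}^*>\mathbf{0}_m,$$ where the strict inequalities hold in every component. *)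

theory Defs
  imports "HOL-Analysis.Analysis"
begin

text \<open>
  The linear fractional program
    max (c \<bullet> x + \<alpha>) / (d \<bullet> x + \<beta>)  subject to  A *v x \<le> b,  0 \<le> x
  and its dual
    min z  subject to  c \<le> transpose A *v y + z d,  - (b \<bullet> y) + \<beta> * z = \<alpha>,  0 \<le> y.

  The weak order on vectors is the library's componentwise order.  The library's strict order
  on vectors only means ``weakly below and different'', so strict inequalities between vectors
  are written out componentwise.
\<close>

definition primal_feasible :: "real^'n^'m \<Rightarrow> real^'m \<Rightarrow> (real^'n) set" where
  "primal_feasible A b = {x. A *v x \<le> b \<and> 0 \<le> x}"

definition dual_feasible ::
  "real^'n^'m \<Rightarrow> real^'m \<Rightarrow> real^'n \<Rightarrow> real^'n \<Rightarrow> real \<Rightarrow> real \<Rightarrow> ((real^'m) \<times> real) set" where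
  "dual_feasible A b c d \<alpha> \<beta> =
     {(y, z). c \<le> transpose A *v y + z *\<^sub>R d \<and> - (b \<bullet> y) + \<beta> * z = \<alpha> \<and> 0 \<le> y}"

text \<open>
  The objective functions do not occur below: the notion asks for feasibility and strict
  complementarity, and optimality is a consequence of these rather than part of the definition.
\<close>

definition feasible_primal_dual_solution ::
  "real^'n^'m \<Rightarrow> real^'m \<Rightarrow> real^'n \<Rightarrow> real^'n \<Rightarrow> real \<Rightarrow> real \<Rightarrow>
   ((real^'n) \<times> (real^'m)) \<times> ((real^'m) \<times> real \<times> (real^'n)) \<Rightarrow> bool" where
  "feasible_primal_dual_solution A b c d \<alpha> \<beta> = (\<lambda>((x, u), (y, z, v)).
     x \<in> primal_feasible A b \<and> (y, z) \<in> dual_feasible A b c d \<alpha> \<beta> \<and>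
     u = b - A *v x \<and> v = transpose A *v y + z *\<^sub>R d - c)"

definition strict_complementary_solution ::
  "real^'n^'m \<Rightarrow> real^'m \<Rightarrow> real^'n \<Rightarrow> real^'n \<Rightarrow> real \<Rightarrow> real \<Rightarrow>
   ((real^'n) \<times> (real^'m)) \<times> ((real^'m) \<times> real \<times> (real^'n)) \<Rightarrow> bool" where
  "strict_complementary_solution A b c d \<alpha> \<beta> = (\<lambda>((x, u), (y, z, v)).
     feasible_primal_dual_solution A b c d \<alpha> \<beta> ((x, u), (y, z, v)) \<and>
     x \<bullet> v = 0 \<and> y \<bullet> u = 0 \<and>
     (\<forall>j. 0 < (x + v) $ j) \<and> (\<forall>i. 0 < (y + u) $ i))"

end

theory Submission
  imports Defs
begin

text \<open>
  Let \<open>z\<close> be the maximal ratio over \<open>X\<close>.  Then the linear functional \<open>c - z d\<close> has maximum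
  \<open>\<beta> z - \<alpha>\<close> over \<open>X\<close>, so the fractional dual restricted to this \<open>z\<close> is the optimal face of
  the linear programming dual of maximising \<open>c - z d\<close> over \<open>X\<close>.  A strictly complementary solution of
  this linear program comes from Tucker's theorem for skew-symmetric maps, applied to the
  homogeneous self-dual system in \<open>(y, x, t)\<close>; boundedness of \<open>X\<close> excludes \<open>t = 0\<close>.
\<close>

section \<open>Farkas' lemma and Tucker's theorem for skew-symmetric maps\<close>

lemma farkas_cone_hull:
  fixes a :: "'a::euclidean_space"
  assumes "finite S" and "\<And>w. (\<And>s. s \<in> S \<Longrightarrow> 0 \<le> w \<bullet> s) \<Longrightarrow> 0 \<le> w \<bullet> a"
  shows "a \<in> convex_cone hull S"
proof (rule ccontr)
  assume "a \<notin> convex_cone hull S"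
  then obtain w r where wa: "w \<bullet> a < r" and wr: "\<And>x. x \<in> convex_cone hull S \<Longrightarrow> r < w \<bullet> x"
    using separating_hyperplane_closed_point[OF convex_convex_cone_hull
        closed_convex_cone_hull[OF assms(1)]] by blast
  have r0: "r < 0"
    using wr[OF convex_cone_hull_contains_0] by simp
  have "0 \<le> w \<bullet> s" if "s \<in> S" for s
  proof (rule ccontr)
    assume neg: "\<not> 0 \<le> w \<bullet> s"
    \<comment> \<open>Both \<open>r\<close> and \<open>w \<bullet> s\<close> are negative, so this
      is a nonnegative multiple of \<open>s\<close>. On it \<open>w\<close> takes the value
      \<open>r\<close> itself, against strict separation.\<close>
    have "(r / (w \<bullet> s)) *\<^sub>R s \<in> convex_cone hull S"
      using that neg r0 by (intro convex_cone_hull_mul hull_inc) (auto simp: divide_nonpos_neg)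
    from wr[OF this] neg show False
      by simp
  qed
  with assms(2)[of w] wa r0 show False
    by auto
qed

text \<open>Either some nonnegative \<open>w\<close> with \<open>K w\<close> nonnegative is already
  positive at \<open>e\<close>, or the two sign conditions force
  \<open>w \<bullet> e \<le> 0\<close>. In the second case Farkas' lemma writes \<open>- e\<close>
  as \<open>p - K q\<close> with \<open>p\<close> and \<open>q\<close> nonnegative, and
  \<open>K q = e + p\<close> is at least 1 at \<open>e\<close>.\<close>

lemma tucker_skew_coordinate:
  fixes K :: "'a::ordered_euclidean_space \<Rightarrow> 'a"
  assumes lin: "linear K" and skew: "\<And>x y. K x \<bullet> y = - (x \<bullet> K y)" and e: "e \<in> Basis"
  obtains w where "0 \<le> w" "0 \<le> K w" "0 < (w + K w) \<bullet> e"
proof (cases "\<exists>w. 0 \<le> w \<and> 0 \<le> K w \<and> 0 < w \<bullet> e")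
  case True
  then obtain w where w: "0 \<le> w" "0 \<le> K w" "0 < w \<bullet> e" by blast
  moreover have "0 \<le> K w \<bullet> e"
    using w(2) e by (metis eucl_le inner_zero_left)
  ultimately show thesis
    by (intro that[of w]) (auto simp: inner_add_left)
next
  case False
  \<comment> \<open>By skew-symmetry \<open>w \<bullet> (- K i) = K w \<bullet> i\<close>, so
    nonnegativity of \<open>w\<close> against all of \<open>S\<close> means that \<open>w\<close>
    and \<open>K w\<close> are both nonnegative.\<close>
  define S where "S = Basis \<union> (\<lambda>i. - K i) ` Basis"
  have "- e \<in> convex_cone hull S"
  proof (rule farkas_cone_hull)
    show "finite S" by (simp add: S_def)
    fix w assume w: "\<And>s. s \<in> S \<Longrightarrow> 0 \<le> w \<bullet> s"
    have "0 \<le> w"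
      using w by (auto simp: eucl_le[of 0 w] S_def)
    moreover have "0 \<le> K w"
      using w[of "- K i" for i] by (auto simp: eucl_le[of 0 "K w"] S_def skew)
    ultimately show "0 \<le> w \<bullet> - e"
      using False by force
  qed
  moreover have "convex_cone hull S \<subseteq> {p - K q |p q. 0 \<le> p \<and> 0 \<le> q}" (is "_ \<subseteq> ?C")
  proof (rule hull_minimal)
    have nn: "0 \<le> i" if "i \<in> Basis" for i :: 'a
      using that by (auto simp: eucl_le[of 0 i] inner_Basis)
    show "S \<subseteq> ?C"
    proof
      fix s assume "s \<in> S"
      then consider "s \<in> Basis" | i where "i \<in> Basis" "s = - K i"
        by (auto simp: S_def)
      then show "s \<in> ?C"
      proof cases
        case 1
        then show ?thesis using nn[of s] linear_0[OF lin]
          by (intro CollectI exI[of _ s] exI[of _ 0]) auto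
      next
        case 2
        then show ?thesis using nn[of i]
          by (intro CollectI exI[of _ 0] exI[of _ i]) auto
      qed
    qed
    show "convex_cone ?C"
      unfolding convex_cone_iff
    proof (intro conjI ballI allI impI)
      show "0 \<in> ?C"
        using linear_0[OF lin] by (intro CollectI exI[of _ 0]) auto
    next
      fix x y assume "x \<in> ?C" "y \<in> ?C"
      then obtain p q p' q' where "x = p - K q" "y = p' - K q'" "0 \<le> p" "0 \<le> q" "0 \<le> p'" "0 \<le> q'"
        by blast
      then show "x + y \<in> ?C"
        by (intro CollectI exI[of _ "p + p'"] exI[of _ "q + q'"]) (auto simp: linear_add[OF lin] eucl_le[where 'a='a] inner_add_left)
    next
      fix x :: 'a and r :: real assume "x \<in> ?C" "0 \<le> r"
      then obtain p q where "x = p - K q" "0 \<le> p" "0 \<le> q"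
        by blast
      with \<open>0 \<le> r\<close> show "r *\<^sub>R x \<in> ?C"
        by (intro CollectI exI[of _ "r *\<^sub>R p"] exI[of _ "r *\<^sub>R q"])
          (auto simp: linear_scale[OF lin] eucl_le[where 'a='a] scaleR_diff_right)
    qed
  qed
  ultimately obtain p q where pq: "- e = p - K q" "0 \<le> p" "0 \<le> q"
    by blast
  then have Kq: "K q = e + p"
    by (simp add: algebra_simps)
  have coord: "0 \<le> p \<bullet> i" "0 \<le> q \<bullet> i" if "i \<in> Basis" for i
    using pq that by (auto simp: eucl_le[where 'a='a])
  show thesis
  proof (rule that[of q])
    show "0 \<le> K q"
    proof -
      have "0 \<le> e \<bullet> i" if "i \<in> Basis" for i
        using e that by (simp add: inner_Basis)
      with coord show ?thesis
        by (simp add: Kq eucl_le[of 0 "e + p"] inner_add_left)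
    qed
    show "0 < (q + K q) \<bullet> e"
      using coord[OF e] e by (simp add: Kq inner_add_left)
  qed (use pq in simp_all)
qed

text \<open>The sign conditions define a convex cone, so the solutions for the single coordinates
  may be added. At coordinate \<open>i\<close> the summand chosen for \<open>i\<close> is positive
  and the others are nonnegative.\<close>

theorem tucker_skew:
  fixes K :: "'a::ordered_euclidean_space \<Rightarrow> 'a"
  assumes lin: "linear K" and skew: "\<And>x y. K x \<bullet> y = - (x \<bullet> K y)"
  obtains w where "0 \<le> w" "0 \<le> K w" "\<And>i. i \<in> Basis \<Longrightarrow> 0 < (w + K w) \<bullet> i"
proof -
  have "\<forall>e\<in>Basis. \<exists>w. 0 \<le> w \<and> 0 \<le> K w \<and> 0 < (w + K w) \<bullet> e"
    using tucker_skew_coordinate[OF assms] by metis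
  then obtain f where f: "\<And>e. e \<in> Basis \<Longrightarrow> 0 \<le> f e \<and> 0 \<le> K (f e) \<and> 0 < (f e + K (f e)) \<bullet> e"
    by metis
  define w where "w = sum f Basis"
  have Kw: "K w = (\<Sum>e\<in>Basis. K (f e))"
    by (simp add: w_def linear_sum[OF lin])
  have nn: "0 \<le> f e \<bullet> i" "0 \<le> K (f e) \<bullet> i" if "e \<in> Basis" "i \<in> Basis" for e i
    using f[OF that(1)] that(2) by (auto simp: eucl_le[where 'a='a])
  show thesis
  proof (rule that[of w])
    show "0 \<le> w"
      by (auto simp: w_def eucl_le[where 'a='a] inner_sum_left intro!: sum_nonneg nn)
    show "0 \<le> K w"
      by (auto simp: Kw eucl_le[where 'a='a] inner_sum_left intro!: sum_nonneg nn)
    fix i :: 'a assume i: "i \<in> Basis"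
    have "(w + K w) \<bullet> i = (\<Sum>e\<in>Basis. (f e + K (f e)) \<bullet> i)"
      by (simp add: w_def linear_sum[OF lin] inner_add_left inner_sum_left sum.distrib)
    moreover have "0 < \<dots>"
      using f i nn by (intro sum_pos2[OF finite_Basis i]) (auto simp: inner_add_left)
    ultimately show "0 < (w + K w) \<bullet> i"
      by simp
  qed
qed

section \<open>Duality and strict complementarity for linear programs\<close>

lemma inner_mono_vec:
  fixes x y z :: "real^'n"
  assumes "0 \<le> x" "y \<le> z"
  shows "x \<bullet> y \<le> x \<bullet> z"
  using assms by (auto simp: inner_vec_def less_eq_vec_def intro!: sum_mono mult_left_mono)

lemma inner_vector_matrix_mult:
  fixes A :: "real^'n^'m"
  shows "x \<bullet> (y v* A) = y \<bullet> (A *v x)"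
  by (metis dot_lmul_matrix inner_commute)

lemma linear_program_weak_duality:
  fixes A :: "real^'n^'m"
  assumes "0 \<le> x" "A *v x \<le> b" "0 \<le> y" "c \<le> transpose A *v y"
  shows "c \<bullet> x \<le> b \<bullet> y"
proof -
  have "c \<bullet> x \<le> x \<bullet> (transpose A *v y)"
    using inner_mono_vec[OF assms(1,4)] by (simp add: inner_commute)
  also have "\<dots> = y \<bullet> (A *v x)"
    by (simp add: inner_vector_matrix_mult)
  also have "\<dots> \<le> b \<bullet> y"
    using inner_mono_vec[OF assms(3,2)] by (simp add: inner_commute)
  finally show ?thesis .
qed

lemma bounded_primal_ray_zero:
  fixes A :: "real^'n^'m"
  assumes "x0 \<in> primal_feasible A b" "bounded (primal_feasible A b)" "0 \<le> x" "A *v x \<le> 0"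
  shows "x = 0"
proof (rule ccontr)
  assume "x \<noteq> 0"
  obtain B where B: "\<And>y. y \<in> primal_feasible A b \<Longrightarrow> norm y \<le> B"
    using assms(2) by (auto simp: bounded_iff)
  \<comment> \<open>This length makes \<open>norm (s *\<^sub>R x)\<close> exceed
    \<open>B + norm x0\<close>, so that the point reached from \<open>x0\<close> along the recession
    direction \<open>x\<close> has norm above \<open>B\<close>.\<close>
  define s where "s = (B + norm x0 + 1) / norm x"
  have B0: "0 \<le> B"
    using B[OF assms(1)] norm_ge_zero order_trans by blast
  then have s0: "0 \<le> s"
    by (simp add: s_def)
  have "x0 + s *\<^sub>R x \<in> primal_feasible A b"
    using assms s0
    by (auto simp: primal_feasible_def matrix_vector_right_distrib matrix_vector_mult_scaleR less_eq_vec_def intro: add_decreasing2 mult_nonneg_nonpos)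
  from B[OF this] have "norm (s *\<^sub>R x) - norm x0 \<le> B"
    using norm_diff_ineq[of "s *\<^sub>R x" x0] by (simp add: add.commute)
  moreover have "norm (s *\<^sub>R x) = B + norm x0 + 1"
    using \<open>x \<noteq> 0\<close> B0 by (simp add: s_def)
  ultimately show False by simp
qed

theorem linear_program_strict_complementarity:
  fixes A :: "real^'n^'m" and b :: "real^'m" and c :: "real^'n"
  assumes x0: "x0 \<in> primal_feasible A b" and bd: "bounded (primal_feasible A b)"
  obtains x y where "x \<in> primal_feasible A b" "0 \<le> y" "c \<le> transpose A *v y" "c \<bullet> x = b \<bullet> y"
    "\<And>j. 0 < (x + (transpose A *v y - c)) $ j" "\<And>i. 0 < (y + (b - A *v x)) $ i"
proof -
  \<comment> \<open>The components of \<open>K\<close> are the primal slack, the dual slack (both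
    homogenised by \<open>t\<close>) and the reversed duality gap. They stand at the places of
    \<open>y\<close>, \<open>x\<close> and \<open>t\<close>, so positivity of \<open>w + K w\<close>
    pairs each variable with its complementary slack.\<close>
  define K :: "((real^'m) \<times> (real^'n) \<times> real) \<Rightarrow> (real^'m) \<times> (real^'n) \<times> real" where
    "K = (\<lambda>(y, x, t). (t *\<^sub>R b - A *v x, transpose A *v y - t *\<^sub>R c, c \<bullet> x - b \<bullet> y))"
  have "linear K"
    by (rule linearI)
      (auto simp: K_def algebra_simps matrix_vector_right_distrib matrix_vector_mult_scaleR
        vector_matrix_left_distrib scaleR_vector_matrix_assoc inner_add_right)
  moreover have "K p \<bullet> q = - (p \<bullet> K q)" for p q
    by (cases p; cases q)
      (auto simp: K_def inner_diff_left inner_diff_right dot_lmul_matrix inner_vector_matrix_mult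
        inner_commute[of _ b] inner_commute[of _ c] inner_commute[of "_ *v _"] algebra_simps)
  ultimately obtain w where "0 \<le> w" "0 \<le> K w" and wpos: "\<And>i. i \<in> Basis \<Longrightarrow> 0 < (w + K w) \<bullet> i"
    using tucker_skew by blast
  moreover obtain y x t where w: "w = (y, x, t)"
    by (cases w)
  ultimately have y: "0 \<le> y" and x: "0 \<le> x" and t: "0 \<le> t" and Ax: "A *v x \<le> t *\<^sub>R b"
    and yA: "t *\<^sub>R c \<le> transpose A *v y" and gap: "b \<bullet> y \<le> c \<bullet> x"
    by (auto simp: K_def less_eq_prod_def zero_prod_def less_eq_vec_def)
  have pos1: "0 < (y + (t *\<^sub>R b - A *v x)) $ i" for i
    using wpos[of "(axis i 1, 0)"]
    by (auto simp: K_def w Basis_prod_def zero_prod_def inner_axis axis_in_Basis_iff)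
  have pos2: "0 < (x + (transpose A *v y - t *\<^sub>R c)) $ j" for j
    using wpos[of "(0, axis j 1, 0)"]
    by (auto simp: K_def w Basis_prod_def zero_prod_def inner_axis axis_in_Basis_iff)
  have pos3: "0 < t + (c \<bullet> x - b \<bullet> y)"
    using wpos[of "(0, 0, 1)"] by (auto simp: K_def w Basis_prod_def zero_prod_def)
  have weak: "t * (c \<bullet> x) \<le> t * (b \<bullet> y)"
    using linear_program_weak_duality[OF x Ax y yA] by simp
  \<comment> \<open>For \<open>t = 0\<close> the vector \<open>x\<close> is a recession direction,
    hence 0, and \<open>y\<close> is dual feasible for the zero objective, hence
    \<open>0 \<le> b \<bullet> y\<close> by weak duality at \<open>x0\<close>. Then
    \<open>t + (c \<bullet> x - b \<bullet> y)\<close> cannot be positive.\<close>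
  have "t \<noteq> 0"
  proof
    assume t0: "t = 0"
    then have "x = 0"
      using bounded_primal_ray_zero[OF x0 bd x] Ax by simp
    moreover have "0 \<le> b \<bullet> y"
      using linear_program_weak_duality[of x0 A b y 0] x0 y yA t0
      by (simp add: primal_feasible_def)
    ultimately show False
      using pos3 t0 by simp
  qed
  with t have t: "0 < t" by simp
  show thesis
  proof (rule that[of "x /\<^sub>R t" "y /\<^sub>R t"])
    have "c \<bullet> x = b \<bullet> y"
      using weak gap t by simp
    then show "c \<bullet> (x /\<^sub>R t) = b \<bullet> (y /\<^sub>R t)" by simp
    show "x /\<^sub>R t \<in> primal_feasible A b"
      using x Ax t by (auto simp: primal_feasible_def less_eq_vec_def matrix_vector_mult_scaleR field_simps)
    show "0 \<le> y /\<^sub>R t"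
      using y t by (auto simp: less_eq_vec_def)
    show "c \<le> transpose A *v (y /\<^sub>R t)"
      using yA t by (auto simp: less_eq_vec_def matrix_vector_mult_scaleR field_simps simp del: transpose_matrix_vector)
    show "0 < (x /\<^sub>R t + (transpose A *v (y /\<^sub>R t) - c)) $ j" for j
      using pos2[of j] t by (simp add: matrix_vector_mult_scaleR field_simps del: transpose_matrix_vector)
    show "0 < (y /\<^sub>R t + (b - A *v (x /\<^sub>R t))) $ i" for i
    proof -
      have "y /\<^sub>R t + (b - A *v (x /\<^sub>R t)) = (y + (t *\<^sub>R b - A *v x)) /\<^sub>R t"
        using t by (simp add: matrix_vector_mult_scaleR scaleR_add_right scaleR_diff_right)
      then show ?thesis
        using pos1[of i] t by simp
    qed
  qed
qed

section \<open>Reduction of the fractional program to a linear one\<close>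

lemma compact_primal_feasible:
  fixes A :: "real^'n^'m"
  assumes "bounded (primal_feasible A b)"
  shows "compact (primal_feasible A b)"
proof -
  have "primal_feasible A b = ((*v) A) -` {..b} \<inter> {0..}"
    by (auto simp: primal_feasible_def)
  moreover have "closed (((*v) A) -` {..b})"
    by (intro continuous_closed_vimage closed_eucl_atMost
        linear_continuous_at matrix_vector_mul_bounded_linear)
  ultimately show ?thesis
    using assms by (metis compact_eq_bounded_closed closed_Int closed_eucl_atLeast)
qed

theorem theorem3p1:
  fixes A :: "real^'n^'m" and b :: "real^'m" and c d :: "real^'n" and \<alpha> \<beta> :: real
  assumes "primal_feasible A b \<noteq> {}"
    and "bounded (primal_feasible A b)"
    and "\<And>x. x \<in> primal_feasible A b \<Longrightarrow> d \<bullet> x + \<beta> > 0"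
  shows "\<exists>x u y z v. strict_complementary_solution A b c d \<alpha> \<beta> ((x, u), (y, z, v))"
proof -
  let ?r = "\<lambda>x. (c \<bullet> x + \<alpha>) / (d \<bullet> x + \<beta>)"
  have cont: "continuous_on (primal_feasible A b) ?r"
    using assms(3) by (intro continuous_intros) force
  obtain x0 where x0: "x0 \<in> primal_feasible A b"
    and max: "\<And>x. x \<in> primal_feasible A b \<Longrightarrow> ?r x \<le> ?r x0"
    using continuous_attains_sup[OF compact_primal_feasible[OF assms(2)] assms(1) cont] by blast
  define z where "z = ?r x0"
  define c' where "c' = c - z *\<^sub>R d"
  have le: "c' \<bullet> x \<le> \<beta> * z - \<alpha>" if "x \<in> primal_feasible A b" for x
    using max[OF that] assms(3)[OF that]
    by (simp add: c'_def inner_diff_left pos_divide_le_eq flip: z_def) (simp add: algebra_simps)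
  have eq: "c' \<bullet> x0 = \<beta> * z - \<alpha>"
  proof -
    have "z * (d \<bullet> x0 + \<beta>) = c \<bullet> x0 + \<alpha>"
      using assms(3)[OF x0] by (simp add: z_def)
    then show ?thesis
      by (simp add: c'_def inner_diff_left algebra_simps)
  qed
  \<comment> \<open>The maximiser \<open>x0\<close> only fixes \<open>z\<close>; it may fail strict
    complementarity, so a possibly different optimal \<open>x\<close> is taken here.\<close>
  obtain x y where x: "x \<in> primal_feasible A b" and y: "0 \<le> y" and c': "c' \<le> transpose A *v y"
    and opt: "c' \<bullet> x = b \<bullet> y"
    and pos: "\<And>j. 0 < (x + (transpose A *v y - c')) $ j" "\<And>i. 0 < (y + (b - A *v x)) $ i"
    using linear_program_strict_complementarity[OF x0 assms(2)] by blast
  define u where "u = b - A *v x"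
  define v where "v = transpose A *v y + z *\<^sub>R d - c"
  have v': "v = transpose A *v y - c'"
    by (simp add: v_def c'_def)
  have x_nn: "0 \<le> x" and Ax: "A *v x \<le> b"
    using x by (auto simp: primal_feasible_def)
  have "c' \<bullet> x0 \<le> b \<bullet> y"
    using x0 y c' by (intro linear_program_weak_duality[of x0 A]) (auto simp: primal_feasible_def)
  \<comment> \<open>The value is squeezed: \<open>\<beta> * z - \<alpha> = c' \<bullet> x0 \<le> b
    \<bullet> y = c' \<bullet> x \<le> \<beta> * z - \<alpha>\<close>. This is the equality
    constraint of the fractional dual.\<close>
  then have by_eq: "b \<bullet> y = \<beta> * z - \<alpha>"
    using le[OF x] eq opt by simp
  have "0 \<le> x \<bullet> v"
    using inner_mono_vec[OF x_nn c'] by (simp add: v' inner_diff_right)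
  moreover have "0 \<le> y \<bullet> u"
    using inner_mono_vec[OF y Ax] by (simp add: u_def inner_diff_right)
  \<comment> \<open>The terms in \<open>A\<close> cancel, and the sum is the duality gap
    \<open>b \<bullet> y - c' \<bullet> x\<close>; two nonnegative terms with sum 0 both
    vanish.\<close>
  moreover have "x \<bullet> v + y \<bullet> u = 0"
    using opt by (simp add: v' u_def inner_diff_right inner_vector_matrix_mult inner_commute)
  ultimately have "x \<bullet> v = 0" "y \<bullet> u = 0"
    by auto
  moreover have "(y, z) \<in> dual_feasible A b c d \<alpha> \<beta>"
    using c' y by_eq by (auto simp: dual_feasible_def c'_def diff_le_eq)
  ultimately have "strict_complementary_solution A b c d \<alpha> \<beta> ((x, u), (y, z, v))"
    using x pos by (auto simp: strict_complementary_solution_def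
        feasible_primal_dual_solution_def u_def v_def c'_def algebra_simps)
  then show ?thesis
    by blast
qed

end
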